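(* For every integer $m\ge 3$ there exists a nested $\mathrm{SQS}(2^m)$ whose underlying SQS is the Boolean $\mathrm{SQS}(2^m)$, which is completely uniform when $m$ is odd and completely quasi-uniform when $m$ is even.
   Context: An $\mathrm{SQS}(v)$ is a pair $(V,\mathcal{B})$ with $|V|=v$ and $\mathcal{B}$ a set of $4$-subsets such that every $3$-subset of $V$ lies in exactly one block. The Boolean $\mathrm{SQS}(2^m)$ has point set $\mathbb{F}_2^m$ and blocks all $4$-sets $\{x,y,z,x+y+z\}$ with $x,y,z$ distinct. A nested $\mathrm{SQS}(v)$ is a pair $(V,\mathscr{B})$ where each element of $\mathscr{B}$ is a partition $\{x,y\mid z,w\}=\{\{x,y\},\{z,w\}\}$ of a $4$-set into two pairs, such that $(V,\{\{x,y,z,w\}:\{x,y\mid z,w\}\in\mathscr{B}\})$ is an $\mathrm{SQS}(v)$ (its underlying SQS); each block is partitioned once. The multiplicity of a pair $\{x,y\}\in\binom{V}{2}$ is the number of elements of $\mathscr{B}$ having $\{x,y\}$ as one of their two parts. The nested SQS is completely uniform if all pairs in $\binom{V}{2}$ have the same positive multiplicity; it is completely quasi-uniform if all pairs in $\binom{V}{2}$ have positive multiplicity, any two multiplicities differ by at most one, and not all multiplicities are equal. *)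

theory Defs
  imports "HOL-Library.Z2" "Jordan_Normal_Form.Matrix"
begin

definition sqs :: "nat \<Rightarrow> 'a set \<Rightarrow> 'a set set \<Rightarrow> bool" where
  "sqs v V B \<longleftrightarrow> finite V \<and> card V = v \<and>
     (\<forall>b\<in>B. b \<subseteq> V \<and> card b = 4) \<and>
     (\<forall>T. T \<subseteq> V \<and> card T = 3 \<longrightarrow> (\<exists>!b. b \<in> B \<and> T \<subseteq> b))"

text \<open>The points of the Boolean system are the vectors of \<open>carrier_vec m :: bit vec set\<close>,
  where \<open>bit\<close> is the field with two elements.\<close>

definition boolean_points :: "nat \<Rightarrow> bit vec set" where
  "boolean_points m = carrier_vec m"

definition boolean_blocks :: "nat \<Rightarrow> bit vec set set" where
  "boolean_blocks m = {{x, y, z, x + y + z} | x y z.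
     x \<in> boolean_points m \<and> y \<in> boolean_points m \<and> z \<in> boolean_points m \<and> distinct [x, y, z]}"

text \<open>A nested block is a partition \<open>{{x, y}, {z, w}}\<close>; the 4-set it partitions is its union.\<close>

definition underlying_blocks :: "'a set set set \<Rightarrow> 'a set set" where
  "underlying_blocks N = Union ` N"

text \<open>Injectivity of \<open>Union\<close> on \<open>N\<close> says that each block is partitioned only once.\<close>

definition nested_sqs :: "nat \<Rightarrow> 'a set \<Rightarrow> 'a set set set \<Rightarrow> bool" where
  "nested_sqs v V N \<longleftrightarrow>
     (\<forall>P\<in>N. \<exists>x y z w. distinct [x, y, z, w] \<and> P = {{x, y}, {z, w}}) \<and>
     inj_on Union N \<and>
     sqs v V (underlying_blocks N)"

definition pairs :: "'a set \<Rightarrow> 'a set set" where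
  "pairs V = {p. p \<subseteq> V \<and> card p = 2}"

definition pair_multiplicity :: "'a set set set \<Rightarrow> 'a set \<Rightarrow> nat" where
  "pair_multiplicity N p = card {P \<in> N. p \<in> P}"

definition completely_uniform :: "'a set \<Rightarrow> 'a set set set \<Rightarrow> bool" where
  "completely_uniform V N \<longleftrightarrow>
     (\<forall>p\<in>pairs V. pair_multiplicity N p > 0) \<and>
     (\<forall>p\<in>pairs V. \<forall>q\<in>pairs V. pair_multiplicity N p = pair_multiplicity N q)"

definition completely_quasi_uniform :: "'a set \<Rightarrow> 'a set set set \<Rightarrow> bool" where
  "completely_quasi_uniform V N \<longleftrightarrow>
     (\<forall>p\<in>pairs V. pair_multiplicity N p > 0) \<and>
     (\<forall>p\<in>pairs V. \<forall>q\<in>pairs V. pair_multiplicity N p \<le> pair_multiplicity N q + 1) \<and>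
     (\<exists>p\<in>pairs V. \<exists>q\<in>pairs V. pair_multiplicity N p \<noteq> pair_multiplicity N q)"

end

theory Submission
  imports Defs "HOL-Library.Transitive_Closure_Table"
begin

text \<open>
  A block of the Boolean system is an affine plane \<open>x + {0, a, b, a + b}\<close> over the field with two
  elements, and splitting it into two pairs amounts to choosing one of its three directions
  \<open>a\<close>, \<open>b\<close>, \<open>a + b\<close>. If parallel planes are split in the same way, the nesting is a choice
  of a point on every line of the projective space, and the multiplicity of \<open>{x, x + d}\<close> is the
  number of lines at which \<open>d\<close> is chosen. Every line has 3 points and every point is on
  \<open>2 ^ (m - 1) - 1\<close> lines, so a choice that is as balanced as possible uses every point
  either \<open>\<lfloor>(2 ^ (m - 1) - 1) / 3\<rfloor>\<close> or \<open>\<lceil>(2 ^ (m - 1) - 1) / 3\<rceil>\<close> times, and the quotient is an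
  integer exactly for odd \<open>m\<close>.

  Such a choice exists in every biregular hypergraph: take one that minimises the sum of the squares
  of the loads. If an edge at which \<open>p\<close> is chosen contains \<open>r\<close>, draw an arc from \<open>p\<close> to \<open>r\<close>;
  shifting the choices along a path shows that the load drops by at most one from the start of a path
  to its end. Double counting over the points reachable from \<open>p\<close>, and over those from which \<open>p\<close> is
  reachable, bounds the load of \<open>p\<close> on both sides.
\<close>

section \<open>Loads of choices on hypergraph edges, and balancing them\<close>

definition load :: "'e set \<Rightarrow> ('e \<Rightarrow> 'a) \<Rightarrow> 'a \<Rightarrow> nat" where
  "load E f p = card {L \<in> E. f L = p}"

lemma load_eq_sum: "finite E \<Longrightarrow> load E f p = (\<Sum>L\<in>E. of_bool (f L = p))"
  by (simp add: load_def Int_def)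

lemma sum_load:
  assumes "finite E" "finite R"
  shows "(\<Sum>p\<in>R. load E f p) = (\<Sum>L\<in>E. of_bool (f L \<in> R))"
proof -
  have "(\<Sum>p\<in>R. load E f p) = (\<Sum>L\<in>E. \<Sum>p\<in>R. of_bool (f L = p))"
    using assms by (subst sum.swap) (simp add: load_eq_sum)
  also have "\<dots> = (\<Sum>L\<in>E. of_bool (f L \<in> R))"
    using assms by (intro sum.cong refl) (simp add: of_bool_def sum.delta')
  finally show ?thesis .
qed

lemma sum_card_Int:
  assumes "finite E" "finite R" "\<And>p. p \<in> R \<Longrightarrow> card {L \<in> E. p \<in> L} = d"
  shows "(\<Sum>L\<in>E. card (L \<inter> R)) = d * card R"
proof -
  have "(\<Sum>L\<in>E. card (L \<inter> R)) = (\<Sum>L\<in>E. \<Sum>p\<in>R. of_bool (p \<in> L))"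
    using assms by (simp add: Int_def conj_commute)
  also have "\<dots> = (\<Sum>p\<in>R. card {L \<in> E. p \<in> L})"
    using assms by (subst sum.swap) (simp add: Int_def)
  also have "\<dots> = d * card R" using assms by simp
  finally show ?thesis .
qed

lemma load_update:
  assumes "finite E" "L \<in> E" "g L = p"
  shows "int (load E (g(L := r)) s) = int (load E g s) - of_bool (s = p) + of_bool (s = r)"
proof -
  have "load E h s = of_bool (h L = s) + (\<Sum>K\<in>E - {L}. of_bool (h K = s))" for h
    using assms by (simp only: load_eq_sum sum.remove)
  note eq = this
  have "(\<Sum>K\<in>E - {L}. of_bool ((g(L := r)) K = s)) = (\<Sum>K\<in>E - {L}. of_bool (g K = s) :: nat)"
    by (intro sum.cong) auto
  with eq[of g] eq[of "g(L := r)"] assms(3) show ?thesis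
    by (auto simp: of_bool_def)
qed

text \<open>Induction from the end of the path: the tail from \<open>y\<close> is shifted first, and
  then the edge \<open>L\<close> giving the arc from \<open>x\<close> to \<open>y\<close> is moved
  to \<open>y\<close>. The second conjunct confines the changes to edges chosen on the tail; as
  \<open>x\<close> is not on it, \<open>L\<close> is still assigned to \<open>x\<close> at that
  moment. The intermediate gains and losses cancel.\<close>

lemma reassign_along_path:
  assumes "rtrancl_path (\<lambda>p r. \<exists>L\<in>E. f L = p \<and> r \<in> L) p xs q"
    and "distinct (p # xs)" "finite E" "\<forall>L\<in>E. f L \<in> L"
  shows "\<exists>g. (\<forall>L\<in>E. g L \<in> L) \<and> (\<forall>L\<in>E. f L \<notin> set (p # xs) \<longrightarrow> g L = f L) \<and>
    (\<forall>r. int (load E g r) = int (load E f r) - of_bool (r = p) + of_bool (r = q))"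
  using assms(1,2)
proof (induction rule: rtrancl_path.induct)
  case (base x)
  then show ?case using assms(4) by (intro exI[of _ f]) auto
next
  case (step x y ys z)
  then obtain g where g: "\<forall>L\<in>E. g L \<in> L" "\<forall>L\<in>E. f L \<notin> set (y # ys) \<longrightarrow> g L = f L"
    "\<forall>r. int (load E g r) = int (load E f r) - of_bool (r = y) + of_bool (r = z)"
    by auto
  from step.hyps(1) obtain L where L: "L \<in> E" "f L = x" "y \<in> L" by auto
  from L g(2) step.prems have gL: "g L = x" by auto
  show ?case
  proof (intro exI[of _ "g(L := y)"] conjI allI)
    show "\<forall>K\<in>E. (g(L := y)) K \<in> K" using g(1) L by auto
    show "\<forall>K\<in>E. f K \<notin> set (x # y # ys) \<longrightarrow> (g(L := y)) K = f K" using g(2) L by auto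
    show "int (load E (g(L := y)) r) = int (load E f r) - of_bool (r = x) + of_bool (r = z)" for r
      using load_update[of E L g x y r] assms(3) L(1) gL g(3) by simp
  qed
qed

text \<open>The bounds put the load strictly between \<open>d/k - 1\<close> and
  \<open>d/k + 1\<close>. So it is \<open>d/k\<close> rounded down or up, and exactly
  \<open>d/k\<close> if \<open>k\<close> divides \<open>d\<close>.\<close>

lemma balanced_choice:
  fixes E :: "'a set set"
  assumes fin: "finite P" and sub: "\<And>L. L \<in> E \<Longrightarrow> L \<subseteq> P" and k: "\<And>L. L \<in> E \<Longrightarrow> card L = k"
    and kpos: "k > 0" and deg: "\<And>p. p \<in> P \<Longrightarrow> card {L \<in> E. p \<in> L} = d"
  shows "\<exists>f. (\<forall>L\<in>E. f L \<in> L) \<and> (\<forall>p\<in>P. d < k * (load E f p + 1) \<and> k * load E f p < d + k)"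
proof -
  have finE: "finite E"
    using fin sub by (meson PowI finite_Pow_iff finite_subset subsetI)
  have "\<exists>f. \<forall>L\<in>E. f L \<in> L"
    using k kpos by (intro bchoice) (metis all_not_in_conv card.empty less_irrefl)
  then obtain f where f: "\<forall>L\<in>E. f L \<in> L"
    and min: "\<And>g. \<forall>L\<in>E. g L \<in> L \<Longrightarrow> (\<Sum>p\<in>P. (load E f p)\<^sup>2) \<le> (\<Sum>p\<in>P. (load E g p)\<^sup>2)"
    using ex_has_least_nat[of "\<lambda>f. \<forall>L\<in>E. f L \<in> L" _ "\<lambda>f. \<Sum>p\<in>P. (load E f p)\<^sup>2"] by metis
  define arc where "arc = (\<lambda>p r. \<exists>L\<in>E. f L = p \<and> r \<in> L)"
  have reach: "load E f p \<le> load E f q + 1" if pq: "arc\<^sup>*\<^sup>* p q" "p \<in> P" "q \<in> P" for p q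
  proof (rule ccontr)
    assume "\<not> ?thesis"
    then have big: "int (load E f p) \<ge> int (load E f q) + 2" by simp
    then have "p \<noteq> q" by auto
    from pq obtain xs where "rtrancl_path arc p xs q" "distinct (p # xs)"
      by (metis rtranclp_eq_rtrancl_path rtrancl_path_distinct)
    then obtain g where g: "\<forall>L\<in>E. g L \<in> L"
      and ld: "\<And>r. int (load E g r) = int (load E f r) - of_bool (r = p) + of_bool (r = q)"
      using reassign_along_path[of E f p xs q] finE f unfolding arc_def by blast
    have split: "(\<Sum>r\<in>P. (int (load E h r))\<^sup>2) = (int (load E h p))\<^sup>2 + (int (load E h q))\<^sup>2
        + (\<Sum>r\<in>P - {p} - {q}. (int (load E h r))\<^sup>2)" for h
      using fin pq \<open>p \<noteq> q\<close> by (simp add: sum.remove[of P p] sum.remove[of "P - {p}" q])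
    have "(\<Sum>r\<in>P - {p} - {q}. (int (load E g r))\<^sup>2) = (\<Sum>r\<in>P - {p} - {q}. (int (load E f r))\<^sup>2)"
      by (intro sum.cong) (auto simp: ld)
    \<comment> \<open>Replacing loads \<open>a\<close>, \<open>b\<close> by \<open>a - 1\<close>,
      \<open>b + 1\<close> changes the sum of squares by \<open>2 * (b - a + 1)\<close>, which is
      negative once \<open>a\<close> is at least \<open>b + 2\<close>.\<close>
    moreover have "(int (load E g p))\<^sup>2 + (int (load E g q))\<^sup>2
        < (int (load E f p))\<^sup>2 + (int (load E f q))\<^sup>2"
      using big \<open>p \<noteq> q\<close> by (simp add: ld power2_eq_square algebra_simps)
    ultimately have "(\<Sum>r\<in>P. (int (load E g r))\<^sup>2) < (\<Sum>r\<in>P. (int (load E f r))\<^sup>2)"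
      by (simp only: split)
    then have "int (\<Sum>r\<in>P. (load E g r)\<^sup>2) < int (\<Sum>r\<in>P. (load E f r)\<^sup>2)" by simp
    with min[OF g] show False by linarith
  qed
  have arcP: "r \<in> P" if "arc p r" for p r using that sub unfolding arc_def by auto
  have arcP': "p \<in> P" if "arc p r" for p r using that sub f unfolding arc_def by auto
  show ?thesis
  proof (intro exI[of _ f] conjI ballI)
    show "f L \<in> L" if "L \<in> E" for L using f that by blast
  next
    fix p assume p: "p \<in> P"
    define S where "S = {r. arc\<^sup>*\<^sup>* r p}"
    have "r \<in> P" if "arc\<^sup>*\<^sup>* r p" for r using that p arcP' by (cases rule: converse_rtranclpE) auto
    then have SP: "S \<subseteq> P" and pS: "p \<in> S" by (auto simp: S_def)
    then have finS: "finite S" using fin finite_subset by blast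
    have "d * card S = (\<Sum>L\<in>E. card (L \<inter> S))" using sum_card_Int[OF finE finS, of d] deg SP by (metis subsetD)
    \<comment> \<open>\<open>S\<close> is closed under predecessors: an edge meeting
      \<open>S\<close> in \<open>r\<close> has an arc from its chosen point to \<open>r\<close>, so
      that point lies in \<open>S\<close> too. Edges missing \<open>S\<close> contribute nothing to
      the left side.\<close>
    also have "\<dots> \<le> (\<Sum>L\<in>E. k * of_bool (f L \<in> S))"
    proof (intro sum_mono)
      fix L assume L: "L \<in> E"
      have "f L \<in> S" if "r \<in> L \<inter> S" for r
        using that L unfolding S_def arc_def
        by (auto intro: converse_rtranclp_into_rtranclp)
      moreover have "card (L \<inter> S) \<le> k"
        using k[OF L] kpos card_mono[of L "L \<inter> S"] card.infinite[of L] by fastforce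
      ultimately show "card (L \<inter> S) \<le> k * of_bool (f L \<in> S)"
        by (cases "L \<inter> S = {}") auto
    qed
    also have "\<dots> = k * (\<Sum>r\<in>S. load E f r)"
      using sum_load[OF finE finS, of f] by (simp only: sum_distrib_left)
    \<comment> \<open>Each term is bounded by \<open>reach\<close>; strictness comes from the term
      at \<open>r = p\<close>. It is what gives the strict bound on the load after dividing by
      \<open>card S\<close>.\<close>
    also have "(\<Sum>r\<in>S. load E f r) < (\<Sum>r\<in>S. load E f p + 1)"
      using pS SP p reach unfolding S_def
      by (intro sum_strict_mono_ex1) (use finS S_def in auto)
    finally have "card S * d < card S * (k * (load E f p + 1))"
      using kpos by (simp add: algebra_simps)
    then show "d < k * (load E f p + 1)" by simp
  next
    fix p assume p: "p \<in> P"
    define R where "R = {r. arc\<^sup>*\<^sup>* p r}"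
    have "r \<in> P" if "arc\<^sup>*\<^sup>* p r" for r using that p arcP by (cases rule: rtranclp.cases) auto
    then have RP: "R \<subseteq> P" and pR: "p \<in> R" by (auto simp: R_def)
    then have finR: "finite R" using fin finite_subset by blast
    have "k * (\<Sum>r\<in>R. load E f r) = (\<Sum>L\<in>E. k * of_bool (f L \<in> R))"
      using sum_load[OF finE finR, of f] by (simp only: sum_distrib_left)
    \<comment> \<open>Dually, \<open>R\<close> is closed under successors, so an edge whose chosen
      point lies in \<open>R\<close> is contained in \<open>R\<close> and contributes its full size
      \<open>k\<close>.\<close>
    also have "\<dots> \<le> (\<Sum>L\<in>E. card (L \<inter> R))"
    proof (intro sum_mono)
      fix L assume L: "L \<in> E"
      show "k * of_bool (f L \<in> R) \<le> card (L \<inter> R)"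
      proof (cases "f L \<in> R")
        case True
        then have "L \<subseteq> R" using L unfolding R_def arc_def
          by (auto intro: rtranclp.rtrancl_into_rtrancl)
        then show ?thesis using k[OF L] by (simp add: Int_absorb2)
      qed simp
    qed
    also have "\<dots> = d * card R" using sum_card_Int[OF finE finR, of d] deg RP by blast
    finally have le: "k * (\<Sum>r\<in>R. load E f r) \<le> d * card R" .
    have "card R * load E f p = (\<Sum>r\<in>R. load E f p)" by simp
    also have "\<dots> < (\<Sum>r\<in>R. load E f r + 1)"
      using pR RP p reach unfolding R_def
      by (intro sum_strict_mono_ex1) (use finR R_def in auto)
    also have "\<dots> = (\<Sum>r\<in>R. load E f r) + card R" unfolding sum.distrib by simp
    finally have "k * (card R * load E f p) < k * ((\<Sum>r\<in>R. load E f r) + card R)"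
      using kpos by simp
    also have "\<dots> \<le> (d + k) * card R" using le by (simp add: algebra_simps)
    finally have "card R * (k * load E f p) < card R * (d + k)" by (simp add: algebra_simps)
    then show "k * load E f p < d + k" by simp
  qed
qed

section \<open>Vectors over the field with two elements\<close>

lemma vec_bit_self [simp]: "x \<in> carrier_vec m \<Longrightarrow> x + x = 0\<^sub>v m" for x :: "bit vec"
  by (intro eq_vecI) auto

lemma vec_bit_cancel [simp]:
  fixes x y :: "bit vec"
  assumes "x \<in> carrier_vec m" "y \<in> carrier_vec m"
  shows "x + (x + y) = y"
  using assoc_add_vec[of x m x y] assms by simp

lemma vec_left_commute:
  fixes x y z :: "bit vec"
  assumes "x \<in> carrier_vec m" "y \<in> carrier_vec m" "z \<in> carrier_vec m"
  shows "x + (y + z) = y + (x + z)"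
  using assoc_add_vec[OF assms] assoc_add_vec[OF assms(2,1,3)] comm_add_vec[OF assms(1,2)] by simp

text \<open>The dimension occurs only in the carrier premises, so each use as rewrite rules fixes it
  explicitly.\<close>

lemmas vec_bit_ac = assoc_add_vec[of _ m] comm_add_vec[of _ m] vec_left_commute[of _ m] for m

lemma vec_bit_add_eq_left_iff:
  fixes x y z :: "bit vec"
  assumes "x \<in> carrier_vec m" "y \<in> carrier_vec m" "z \<in> carrier_vec m"
  shows "x + y = x + z \<longleftrightarrow> y = z"
proof
  assume "x + y = x + z"
  then have "x + (x + y) = x + (x + z)" by simp
  then show "y = z" using assms by simp
qed simp

lemma vec_bit_add_eq_0_iff:
  fixes x y :: "bit vec"
  assumes "x \<in> carrier_vec m" "y \<in> carrier_vec m"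
  shows "x + y = 0\<^sub>v m \<longleftrightarrow> x = y"
  using vec_bit_add_eq_left_iff[OF assms(1,2,1)] assms by auto

lemma UNIV_bit: "(UNIV :: bit set) = {0, 1}"
  by (auto intro: bit.exhaust)

text \<open>\<open>vec_of_list\<close> is a bijection from the bit lists of length \<open>m\<close>,
  which are easily counted.\<close>

lemma boolean_points_finite_card: "finite (boolean_points m)" "card (boolean_points m) = 2 ^ m"
proof -
  let ?W = "{xs. set xs \<subseteq> {0, 1 :: bit} \<and> length xs = m}"
  have inj: "inj_on vec_of_list ?W"
    by (rule inj_on_inverseI[of _ list_of_vec]) (rule list_vec)
  have img: "boolean_points m = vec_of_list ` ?W"
  proof (intro equalityI subsetI)
    fix v :: "bit vec" assume v: "v \<in> boolean_points m"
    show "v \<in> vec_of_list ` ?W"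
    proof (rule image_eqI[of _ _ "list_of_vec v"])
      show "v = vec_of_list (list_of_vec v)" by (rule vec_list[symmetric])
      show "list_of_vec v \<in> ?W" using v UNIV_bit by (auto simp: boolean_points_def)
    qed
  qed (auto simp only: boolean_points_def carrier_dim_vec dim_vec_of_list mem_Collect_eq image_iff)
  show "finite (boolean_points m)"
    unfolding img by (intro finite_imageI finite_lists_length_eq) simp
  show "card (boolean_points m) = 2 ^ m"
    unfolding img card_image[OF inj]
    using card_lists_length_eq[of "{0, 1 :: bit}" m] by (simp add: numeral_2_eq_2)
qed

section \<open>Points and lines of the binary projective space\<close>

definition directions :: "nat \<Rightarrow> bit vec set" where
  "directions m = carrier_vec m - {0\<^sub>v m}"

text \<open>Two-dimensional subspaces without their zero vector, that is, lines of the projective space.\<close>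

definition lines :: "nat \<Rightarrow> bit vec set set" where
  "lines m = {{a, b, a + b} | a b. a \<in> directions m \<and> b \<in> directions m \<and> a \<noteq> b}"

lemma lineI: "a \<in> directions m \<Longrightarrow> b \<in> directions m \<Longrightarrow> a \<noteq> b \<Longrightarrow> {a, b, a + b} \<in> lines m"
  by (auto simp: lines_def)

lemma directions_carrier: "a \<in> directions m \<Longrightarrow> a \<in> carrier_vec m"
  by (simp add: directions_def)

lemma directions_distinct:
  assumes "a \<in> directions m" "b \<in> directions m" "a \<noteq> b"
  shows "a + b \<in> directions m" "a + b \<noteq> a" "a + b \<noteq> b"
proof -
  have c: "a \<in> carrier_vec m" "b \<in> carrier_vec m" using assms by (auto simp: directions_def)
  show "a + b \<in> directions m" using c assms(3) by (simp add: directions_def vec_bit_add_eq_0_iff)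
  show "a + b \<noteq> a" using vec_bit_add_eq_left_iff[of a m b "0\<^sub>v m"] c assms by (auto simp: directions_def)
  show "a + b \<noteq> b" using vec_bit_add_eq_left_iff[of b m a "0\<^sub>v m"] c assms comm_add_vec[of a m b]
    by (auto simp: directions_def)
qed

lemma lines_subset_directions: "L \<in> lines m \<Longrightarrow> L \<subseteq> directions m"
  by (auto simp: lines_def directions_distinct)

lemma card_line: "L \<in> lines m \<Longrightarrow> card L = 3"
  using directions_distinct by (fastforce simp: lines_def)

text \<open>In characteristic two, any two of \<open>a\<close>, \<open>b\<close>,
  \<open>a + b\<close> sum to the third, so two points determine their line.\<close>

lemma line_eqI:
  assumes "L \<in> lines m" "u \<in> L" "v \<in> L" "u \<noteq> v"
  shows "L = {u, v, u + v}"
proof -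
  obtain a b where ab: "L = {a, b, a + b}" "a \<in> directions m" "b \<in> directions m"
    using assms(1) by (auto simp: lines_def)
  then have "a \<in> carrier_vec m" "b \<in> carrier_vec m" by (auto simp: directions_def)
  with assms(2-4) show ?thesis unfolding ab(1) by (auto simp: vec_bit_ac[of _ m])
qed

lemma line_through:
  assumes "L \<in> lines m" "u \<in> L"
  obtains v where "v \<in> directions m" "v \<noteq> u" "L = {u, v, u + v}"
proof -
  have "\<not> L \<subseteq> {u}" using card_line[OF assms(1)] card_mono[of "{u}" L] by fastforce
  then obtain v where "v \<in> L" "v \<noteq> u" by auto
  then show ?thesis using that line_eqI[of L m u v] assms lines_subset_directions by blast
qed

lemma card_directions: "card (directions m) = 2 ^ m - 1"
  using boolean_points_finite_card[of m] by (simp add: directions_def boolean_points_def)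

lemma finite_directions: "finite (directions m)"
  using boolean_points_finite_card[of m] by (simp add: directions_def boolean_points_def)

text \<open>Deleting \<open>p\<close> from the lines through it partitions the other
  \<open>2 ^ m - 2\<close> directions into pairs: each direction lies on a line with
  \<open>p\<close>, and two lines sharing \<open>p\<close> and a further point coincide.\<close>

lemma card_lines_through:
  assumes "p \<in> directions m" "m > 0"
  shows "card {L \<in> lines m. p \<in> L} = 2 ^ (m - 1) - 1"
proof -
  let ?C = "(\<lambda>L. L - {p}) ` {L \<in> lines m. p \<in> L}"
  have U: "\<Union> ?C = directions m - {p}"
  proof
    show "\<Union> ?C \<subseteq> directions m - {p}" using lines_subset_directions by blast
    show "directions m - {p} \<subseteq> \<Union> ?C"
    proof
      fix q assume "q \<in> directions m - {p}"
      then have "{p, q, p + q} \<in> {L \<in> lines m. p \<in> L}" "q \<in> {p, q, p + q} - {p}"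
        using assms(1) by (auto simp: lines_def)
      then show "q \<in> \<Union> ?C" by blast
    qed
  qed
  have inj: "inj_on (\<lambda>L. L - {p}) {L \<in> lines m. p \<in> L}" by (auto intro!: inj_onI)
  have "finite (\<Union> ?C)" unfolding U using finite_directions by simp
  then have "2 * card ?C = card (\<Union> ?C)"
  proof (intro card_partition)
    show "finite ?C" using \<open>finite (\<Union> ?C)\<close> by (rule finite_UnionD)
    show "card c = 2" if "c \<in> ?C" for c using that card_line by auto
    show "c \<inter> c' = {}" if "c \<in> ?C" "c' \<in> ?C" "c \<noteq> c'" for c c'
      using that line_eqI[of _ m p] by blast
  qed
  also have "\<dots> = 2 ^ m - 2" unfolding U using assms finite_directions by (simp add: card_directions)
  also have "(2::nat) ^ m = 2 * 2 ^ (m - 1)" using assms(2) by (simp flip: power_Suc)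
  finally show ?thesis using card_image[OF inj] by simp
qed

section \<open>Boolean blocks as affine planes, and the Steiner property\<close>

definition plane :: "nat \<Rightarrow> bit vec \<Rightarrow> bit vec set \<Rightarrow> bit vec set" where
  "plane m x L = (\<lambda>l. x + l) ` insert (0\<^sub>v m) L"

text \<open>Sums are differences here, so for a plane these are the nonzero vectors of its direction
  space. Reading them off the block itself avoids fixing a base point.\<close>

definition plane_directions :: "bit vec set \<Rightarrow> bit vec set" where
  "plane_directions B = {u + v | u v. u \<in> B \<and> v \<in> B \<and> u \<noteq> v}"

lemma boolean_blockI:
  assumes "x \<in> carrier_vec m" "y \<in> carrier_vec m" "z \<in> carrier_vec m" "distinct [x, y, z]"
  shows "{x, y, z, x + y + z} \<in> boolean_blocks m"
  unfolding boolean_blocks_def boolean_points_def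
  by (rule CollectI, rule exI[of _ x], rule exI[of _ y], rule exI[of _ z]) (use assms in simp)

text \<open>Seen from \<open>x\<close>, the other points of \<open>{x, y, z, x + y + z}\<close> lie
  in directions \<open>x + y\<close>, \<open>x + z\<close> and \<open>y + z\<close>, the last being
  the sum of the first two.\<close>

lemma boolean_blocks_eq: "boolean_blocks m = {plane m x L | x L. x \<in> carrier_vec m \<and> L \<in> lines m}"
proof (intro equalityI subsetI)
  fix B assume "B \<in> boolean_blocks m"
  then obtain x y z where B: "B = {x, y, z, x + y + z}" and c: "x \<in> carrier_vec m" "y \<in> carrier_vec m"
    "z \<in> carrier_vec m" and d: "x \<noteq> y" "x \<noteq> z" "y \<noteq> z"
    by (auto simp: boolean_blocks_def boolean_points_def)
  have "{x + y, x + z, (x + y) + (x + z)} \<in> lines m"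
    using c d by (intro lineI) (auto simp: directions_def vec_bit_add_eq_0_iff vec_bit_add_eq_left_iff[of _ m])
  moreover have "B = plane m x {x + y, x + z, (x + y) + (x + z)}"
    unfolding B plane_def using c by (simp add: vec_bit_ac[of _ m])
  ultimately show "B \<in> {plane m x L | x L. x \<in> carrier_vec m \<and> L \<in> lines m}" using c by blast
next
  fix B assume "B \<in> {plane m x L | x L. x \<in> carrier_vec m \<and> L \<in> lines m}"
  then obtain x a b where B: "B = plane m x {a, b, a + b}" and x: "x \<in> carrier_vec m"
    and ab: "a \<in> directions m" "b \<in> directions m" "a \<noteq> b"
    by (auto simp: lines_def)
  then have c: "a \<in> carrier_vec m" "b \<in> carrier_vec m" "a \<noteq> 0\<^sub>v m" "b \<noteq> 0\<^sub>v m"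
    by (auto simp: directions_def)
  have "distinct [x, x + a, x + b]"
    using c x ab(3) vec_bit_add_eq_left_iff[of x m "0\<^sub>v m"] by (auto simp: vec_bit_add_eq_left_iff[of _ m])
  moreover have "B = {x, x + a, x + b, x + (x + a) + (x + b)}"
    unfolding B plane_def using x c by (simp add: vec_bit_ac[of _ m])
  ultimately show "B \<in> boolean_blocks m"
    using boolean_blockI[of x m "x + a" "x + b"] x c by simp
qed

text \<open>With \<open>y = x + d\<close> and \<open>L = {d, e, d + e}\<close>, translation by
  \<open>d\<close> only permutes the subspace formed by \<open>L\<close> and zero.\<close>

lemma plane_base_change:
  assumes "x \<in> carrier_vec m" "L \<in> lines m" "y \<in> plane m x L"
  shows "plane m x L = plane m y L"
proof (cases "y = x")
  case False
  then obtain d where d: "d \<in> L" "y = x + d" using assms by (auto simp: plane_def)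
  obtain e where e: "e \<in> directions m" "L = {d, e, d + e}"
    using line_through[OF assms(2) d(1)] by metis
  have "d \<in> carrier_vec m" "e \<in> carrier_vec m"
    using d e lines_subset_directions[OF assms(2)] directions_carrier by auto
  then show ?thesis using assms(1) unfolding e(2) d(2) plane_def
    by (auto simp: vec_bit_ac[of _ m])
qed auto

text \<open>Once the base point is moved to \<open>u\<close>, any other point is
  \<open>u + l\<close> with \<open>l\<close> in \<open>L\<close>, and \<open>u\<close> cancels in
  the difference. Hence parallel planes have the same line.\<close>

lemma plane_directions_plane:
  assumes "x \<in> carrier_vec m" "L \<in> lines m"
  shows "plane_directions (plane m x L) = L"
proof (intro equalityI subsetI)
  fix d assume "d \<in> plane_directions (plane m x L)"
  then obtain u v where uv: "u \<in> plane m x L" "v \<in> plane m x L" "u \<noteq> v" "d = u + v"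
    by (auto simp: plane_directions_def)
  have "L \<subseteq> carrier_vec m" using lines_subset_directions[OF assms(2)] directions_carrier by auto
  then have u: "u \<in> carrier_vec m" using uv(1) assms(1) by (auto simp: plane_def)
  have "v \<in> plane m u L" using plane_base_change[OF assms uv(1)] uv(2) by simp
  then obtain l where "l \<in> L" "v = u + l" using uv(3) u by (auto simp: plane_def)
  then show "d \<in> L" using uv(4) u \<open>L \<subseteq> carrier_vec m\<close> by auto
next
  fix d assume d: "d \<in> L"
  then have c: "d \<in> carrier_vec m" "d \<noteq> 0\<^sub>v m"
    using lines_subset_directions[OF assms(2)] by (auto simp: directions_def)
  then have "x \<noteq> x + d" using vec_bit_add_eq_left_iff[of x m "0\<^sub>v m" d] assms by auto
  moreover have "d = x + (x + d)" using c assms by simp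
  moreover have "x \<in> plane m x L" "x + d \<in> plane m x L"
    using d assms(1) by (auto simp: plane_def image_iff intro: bexI[of _ "0\<^sub>v m"])
  ultimately show "d \<in> plane_directions (plane m x L)" unfolding plane_directions_def by blast
qed

lemma block_eq_plane:
  assumes "B \<in> boolean_blocks m" "x \<in> B"
  shows "B = plane m x (plane_directions B)" "plane_directions B \<in> lines m" "x \<in> carrier_vec m"
proof -
  obtain y L where B: "B = plane m y L" and yL: "y \<in> carrier_vec m" "L \<in> lines m"
    using assms(1) by (auto simp: boolean_blocks_eq)
  then show "plane_directions B \<in> lines m" "B = plane m x (plane_directions B)"
    using plane_directions_plane[OF yL] plane_base_change[OF yL] assms(2) by auto
  show "x \<in> carrier_vec m"
    using assms(2) yL lines_subset_directions[OF yL(2)] directions_carrier unfolding B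
    by (fastforce simp: plane_def)
qed

text \<open>The points are listed so that the split in direction \<open>d\<close> is visible:
  \<open>{x, x + d}\<close> against \<open>{x + e, x + e + d}\<close>.\<close>

lemma plane_eq:
  assumes "x \<in> carrier_vec m" "L \<in> lines m" "d \<in> L"
  obtains e where "distinct [x, x + d, x + e, x + e + d]" "plane m x L = {x, x + d, x + e, x + e + d}"
    "d \<in> carrier_vec m" "e \<in> carrier_vec m"
proof -
  obtain e where e: "e \<in> directions m" "e \<noteq> d" "L = {d, e, d + e}"
    by (rule line_through[OF assms(2,3)])
  have d: "d \<in> directions m" using lines_subset_directions[OF assms(2)] assms(3) by auto
  then have c: "d \<in> carrier_vec m" "e \<in> carrier_vec m" "d \<noteq> 0\<^sub>v m" "e \<noteq> 0\<^sub>v m"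
    using e by (auto simp: directions_def)
  have eq: "x + e + d = x + (d + e)" using c assms(1) by (simp add: vec_bit_ac[of _ m])
  have ne: "x + k \<noteq> x + l" if "k \<noteq> l" "k \<in> carrier_vec m" "l \<in> carrier_vec m" for k l
    using that vec_bit_add_eq_left_iff[of x m k l] assms(1) by blast
  have "x \<noteq> x + l" if "l \<in> directions m" for l
    using that ne[of "0\<^sub>v m" l] assms(1) unfolding directions_def by force
  then have "distinct [x, x + d, x + e, x + e + d]"
    unfolding eq
    using directions_distinct[OF d e(1) e(2)[symmetric]] ne[of d e] ne[of d "d + e"] ne[of e "d + e"]
      d e(1,2) c(1,2) by (metis add_carrier_vec distinct_length_2_or_more distinct_singleton)
  moreover have "plane m x L = {x, x + d, x + e, x + e + d}"
    unfolding eq e(3) plane_def using assms(1) by auto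
  ultimately show ?thesis using c(1,2) by (rule that)
qed

lemma sqs_boolean: "sqs (2 ^ m) (boolean_points m) (boolean_blocks m)"
  unfolding sqs_def
proof (intro conjI ballI allI impI)
  show "finite (boolean_points m)" "card (boolean_points m) = 2 ^ m"
    using boolean_points_finite_card by auto
next
  fix B assume B: "B \<in> boolean_blocks m"
  then show "B \<subseteq> boolean_points m" using block_eq_plane(3) by (auto simp: boolean_points_def)
  obtain x where x: "x \<in> B" using B by (auto simp: boolean_blocks_def)
  note P = block_eq_plane[OF B x]
  then obtain d where "d \<in> plane_directions B" using card_line by fastforce
  then obtain e where "distinct [x, x + d, x + e, x + e + d]" "B = {x, x + d, x + e, x + e + d}"
    using plane_eq[OF P(3,2)] P(1) by metis
  then show "card B = 4" by simp
next
  fix T assume T: "T \<subseteq> boolean_points m \<and> card T = 3"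
  then obtain x y z where T': "T = {x, y, z}" "x \<noteq> y" "x \<noteq> z" "y \<noteq> z" by (auto simp: card_3_iff)
  then have c: "x \<in> carrier_vec m" "y \<in> carrier_vec m" "z \<in> carrier_vec m"
    using T by (auto simp: boolean_points_def)
  show "\<exists>!B. B \<in> boolean_blocks m \<and> T \<subseteq> B"
  proof (rule ex1I)
    show "{x, y, z, x + y + z} \<in> boolean_blocks m \<and> T \<subseteq> {x, y, z, x + y + z}"
      using T' c boolean_blockI[of x m y z] by simp
  next
    fix B assume B: "B \<in> boolean_blocks m \<and> T \<subseteq> B"
    then have P: "B = plane m x (plane_directions B)" "plane_directions B \<in> lines m"
      using T' block_eq_plane by auto
    \<comment> \<open>Uniqueness: two directions of \<open>B\<close> fix its line, and the line
      together with the point \<open>x\<close> fixes the plane.\<close>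
    have "x + y \<in> plane_directions B" "x + z \<in> plane_directions B" "x + y \<noteq> x + z"
      using B T' c by (auto simp: plane_directions_def vec_bit_add_eq_left_iff[of _ m])
    then have "plane_directions B = {x + y, x + z, (x + y) + (x + z)}"
      using line_eqI P(2) by blast
    then show "B = {x, y, z, x + y + z}"
      using P(1) c by (simp add: plane_def vec_bit_ac[of _ m])
  qed
qed

section \<open>The nesting given by a choice of a point on every line\<close>

definition nest :: "(bit vec set \<Rightarrow> bit vec) \<Rightarrow> bit vec set \<Rightarrow> bit vec set set" where
  "nest f B = (\<lambda>y. {y, y + f (plane_directions B)}) ` B"

text \<open>Translation by the chosen direction swaps the points of the block in pairs, and both
  ends of a pair have the same image, so only two parts remain.\<close>

lemma nest_eq:
  assumes "\<forall>L\<in>lines m. f L \<in> L" "B \<in> boolean_blocks m" "x \<in> B"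
  obtains y where "nest f B = {{x, x + f (plane_directions B)}, {y, y + f (plane_directions B)}}"
    "distinct [x, x + f (plane_directions B), y, y + f (plane_directions B)]"
    "B = {x, x + f (plane_directions B), y, y + f (plane_directions B)}"
proof -
  note P = block_eq_plane[OF assms(2,3)]
  define d where "d = f (plane_directions B)"
  have "d \<in> plane_directions B" using P(2) assms(1) by (simp add: d_def)
  then obtain e where e: "distinct [x, x + d, x + e, x + e + d]" "B = {x, x + d, x + e, x + e + d}"
    "d \<in> carrier_vec m" "e \<in> carrier_vec m"
    using plane_eq[OF P(3,2)] P(1) by metis
  have "(\<lambda>y. {y, y + d}) ` B = {{x, x + d}, {x + e, x + e + d}}"
    unfolding e(2) using e(3,4) P(3) by (auto simp: vec_bit_ac[of _ m])
  then show ?thesis using that[of "x + e"] e(1,2) unfolding nest_def d_def by blast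
qed

lemma boolean_blocks_nonempty: "B \<in> boolean_blocks m \<Longrightarrow> \<exists>x. x \<in> B"
  by (auto simp: boolean_blocks_def)

lemma Union_nest:
  assumes "\<forall>L\<in>lines m. f L \<in> L" "B \<in> boolean_blocks m"
  shows "\<Union> (nest f B) = B"
proof -
  obtain x where "x \<in> B" using boolean_blocks_nonempty[OF assms(2)] by blast
  from nest_eq[OF assms this] show ?thesis
    by (metis Un_insert_left Union_insert Union_empty sup_bot.left_neutral sup_bot.right_neutral)
qed

lemma underlying_blocks_nest:
  assumes "\<forall>L\<in>lines m. f L \<in> L"
  shows "underlying_blocks (nest f ` boolean_blocks m) = boolean_blocks m"
  using Union_nest[OF assms] by (simp add: underlying_blocks_def image_image)

lemma nested_sqs_nest:
  assumes "\<forall>L\<in>lines m. f L \<in> L"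
  shows "nested_sqs (2 ^ m) (boolean_points m) (nest f ` boolean_blocks m)"
  unfolding nested_sqs_def underlying_blocks_nest[OF assms]
proof (intro conjI ballI sqs_boolean)
  fix P assume "P \<in> nest f ` boolean_blocks m"
  then obtain B where B: "B \<in> boolean_blocks m" "P = nest f B" by auto
  then obtain x where "x \<in> B" using boolean_blocks_nonempty by blast
  from nest_eq[OF assms B(1) this] B(2)
  show "\<exists>x y z w. distinct [x, y, z, w] \<and> P = {{x, y}, {z, w}}" by metis
next
  show "inj_on Union (nest f ` boolean_blocks m)"
    using Union_nest[OF assms] by (auto intro!: inj_onI)
qed

text \<open>Blocks through \<open>x\<close> correspond to lines \<open>L\<close> via
  \<open>plane m x L\<close>. The part of such a block containing \<open>x\<close> is
  \<open>{x, x + f L}\<close>, so the pair is counted once for each line at which \<open>d\<close>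
  is chosen.\<close>

lemma pair_multiplicity_nest:
  assumes f: "\<forall>L\<in>lines m. f L \<in> L" and x: "x \<in> carrier_vec m" and d: "d \<in> directions m"
  shows "pair_multiplicity (nest f ` boolean_blocks m) {x, x + d} = load (lines m) f d"
proof -
  have dc: "d \<in> carrier_vec m" using d directions_carrier by auto
  have mem: "{x, x + d} \<in> nest f B \<longleftrightarrow> x \<in> B \<and> f (plane_directions B) = d"
    if B: "B \<in> boolean_blocks m" for B
  proof
    assume xd: "{x, x + d} \<in> nest f B"
    then have "x \<in> B" using Union_nest[OF f B] by blast
    then obtain y where y: "nest f B = {{x, x + f (plane_directions B)}, {y, y + f (plane_directions B)}}"
      "distinct [x, x + f (plane_directions B), y, y + f (plane_directions B)]"
      using nest_eq[OF f B] by metis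
    \<comment> \<open>Distinctness keeps \<open>x\<close> out of the second part, so the pair must
      be the first one.\<close>
    then have "x + d = x + f (plane_directions B)" using xd by (auto simp: doubleton_eq_iff)
    moreover have "f (plane_directions B) \<in> carrier_vec m"
      using block_eq_plane(2)[OF B \<open>x \<in> B\<close>] f lines_subset_directions directions_carrier by blast
    ultimately show "x \<in> B \<and> f (plane_directions B) = d"
      using \<open>x \<in> B\<close> x dc by (simp add: vec_bit_add_eq_left_iff[of _ m])
  qed (auto simp: nest_def)
  have "{P \<in> nest f ` boolean_blocks m. {x, x + d} \<in> P}
      = (\<lambda>L. nest f (plane m x L)) ` {L \<in> lines m. f L = d}" (is "?A = ?g ` ?B")
  proof (intro equalityI subsetI)
    fix P assume "P \<in> ?A"
    then obtain B where B: "B \<in> boolean_blocks m" "P = nest f B" "x \<in> B" "f (plane_directions B) = d"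
      using mem by auto
    then show "P \<in> ?g ` ?B" using block_eq_plane[OF B(1,3)]
      by (intro image_eqI[of _ _ "plane_directions B"]) auto
  next
    fix P assume "P \<in> ?g ` ?B"
    then obtain L where L: "L \<in> lines m" "f L = d" "P = nest f (plane m x L)" by auto
    have "plane m x L \<in> boolean_blocks m" using L x by (auto simp: boolean_blocks_eq)
    moreover have "x \<in> plane m x L" using x by (auto simp: plane_def image_iff)
    ultimately show "P \<in> ?A" using mem plane_directions_plane[OF x L(1)] L by auto
  qed
  \<comment> \<open>The union of the nested block recovers the plane, whose directions recover the
    line.\<close>
  moreover have "inj_on ?g ?B"
  proof (rule inj_onI)
    fix K L assume KL: "K \<in> ?B" "L \<in> ?B" "?g K = ?g L"
    have "plane m x K \<in> boolean_blocks m" "plane m x L \<in> boolean_blocks m"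
      using KL x by (auto simp: boolean_blocks_eq)
    then have "plane m x K = plane m x L" using KL(3) Union_nest[OF f] by metis
    then show "K = L" using plane_directions_plane[OF x] KL by (metis (lifting) mem_Collect_eq)
  qed
  ultimately show ?thesis by (simp add: pair_multiplicity_def load_def card_image)
qed

lemma pairs_boolean_points:
  "p \<in> pairs (boolean_points m) \<longleftrightarrow> (\<exists>x\<in>carrier_vec m. \<exists>d\<in>directions m. p = {x, x + d})"
proof
  assume "p \<in> pairs (boolean_points m)"
  then obtain x y where p: "p = {x, y}" "x \<noteq> y" "x \<in> carrier_vec m" "y \<in> carrier_vec m"
    by (auto simp: pairs_def boolean_points_def card_2_iff)
  then have "x + y \<in> directions m" "y = x + (x + y)"
    by (auto simp: directions_def vec_bit_add_eq_0_iff)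
  with p show "\<exists>x\<in>carrier_vec m. \<exists>d\<in>directions m. p = {x, x + d}" by metis
next
  assume "\<exists>x\<in>carrier_vec m. \<exists>d\<in>directions m. p = {x, x + d}"
  then obtain x d where "x \<in> carrier_vec m" "d \<in> carrier_vec m" "d \<noteq> 0\<^sub>v m" "p = {x, x + d}"
    by (auto simp: directions_def)
  then show "p \<in> pairs (boolean_points m)"
    using vec_bit_add_eq_left_iff[of x m "0\<^sub>v m" d] by (auto simp: pairs_def boolean_points_def card_2_iff)
qed

section \<open>Multiplicities for odd and even dimension\<close>

lemma four_power_mod_3: "(4::nat) ^ n mod 3 = 1"
  by (induction n) (simp, simp, presburger)

theorem theorem4p8:
  fixes m :: nat
  assumes "m \<ge> 3"
  shows "\<exists>N :: bit vec set set set.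
           nested_sqs (2 ^ m) (boolean_points m) N \<and>
           underlying_blocks N = boolean_blocks m \<and>
           (odd m \<longrightarrow> completely_uniform (boolean_points m) N) \<and>
           (even m \<longrightarrow> completely_quasi_uniform (boolean_points m) N)"
proof -
  define d :: nat where "d = 2 ^ (m - 1) - 1"
  have deg: "card {L \<in> lines m. p \<in> L} = d" if "p \<in> directions m" for p
    using card_lines_through[OF that] assms by (simp add: d_def)
  obtain f where f: "\<forall>L\<in>lines m. f L \<in> L" and
    ld: "\<And>p. p \<in> directions m \<Longrightarrow> d < 3 * (load (lines m) f p + 1) \<and> 3 * load (lines m) f p < d + 3"
    using balanced_choice[of "directions m" "lines m" 3 d] finite_directions lines_subset_directions
      card_line deg by auto
  define N where "N = nest f ` boolean_blocks m"
  have mult: "\<exists>a\<in>directions m. pair_multiplicity N p = load (lines m) f a"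
    if "p \<in> pairs (boolean_points m)" for p
    using that pair_multiplicity_nest[OF f] unfolding pairs_boolean_points N_def by blast
  \<comment> \<open>This is where \<open>m\<close> at least 3 enters: \<open>d\<close> is then at
    least 3, so the lower bound on the loads forces them to be positive.\<close>
  have "(2::nat) ^ 2 \<le> 2 ^ (m - 1)" using assms by (intro power_increasing) auto
  then have d3: "d \<ge> 3" by (simp add: d_def)
  have pos: "pair_multiplicity N p > 0" if "p \<in> pairs (boolean_points m)" for p
    using mult[OF that] ld d3 by fastforce
  have "completely_uniform (boolean_points m) N" if "odd m"
  proof -
    from that obtain n where "m = 2 * n + 1" by (elim oddE)
    then have "d = 4 ^ n - 1" by (simp add: d_def power_mult)
    \<comment> \<open>Now \<open>d/3\<close> is an integer, hence the only one allowed by the strict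
      bounds.\<close>
    then have "d mod 3 = 0" using four_power_mod_3[of n] by presburger
    then have "3 * load (lines m) f a = d" if "a \<in> directions m" for a
      using ld[OF that] by presburger
    then have "3 * pair_multiplicity N p = d" if "p \<in> pairs (boolean_points m)" for p
      using mult[OF that] by auto
    then show ?thesis unfolding completely_uniform_def using pos
      by (metis mult_cancel1 zero_neq_numeral)
  qed
  moreover have "completely_quasi_uniform (boolean_points m) N" if "even m"
  proof -
    from that assms obtain n where "m = 2 * Suc n"
      by (metis dvdE not0_implies_Suc mult_0_right not_numeral_le_zero)
    then have "d = 2 * 4 ^ n - 1" by (simp add: d_def power_mult)
    moreover have "(4::nat) ^ n = 3 * (4 ^ n div 3) + 1"
      using four_power_mod_3[of n] mult_div_mod_eq[of 3 "(4::nat) ^ n"] by simp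
    \<comment> \<open>Here \<open>d\<close> is 1 modulo 3, so no load can equal
      \<open>d/3\<close>.\<close>
    ultimately have d: "d = 3 * (2 * (4 ^ n div 3)) + 1" by linarith
    have near: "d < 3 * (pair_multiplicity N p + 1) \<and> 3 * pair_multiplicity N p < d + 3"
      if "p \<in> pairs (boolean_points m)" for p
      using mult[OF that] ld by auto
    have "\<exists>p\<in>pairs (boolean_points m). \<exists>q\<in>pairs (boolean_points m).
        pair_multiplicity N p \<noteq> pair_multiplicity N q"
    proof (rule ccontr)
      assume eq: "\<not> ?thesis"
      have "card (directions m) > 0" using assms one_less_power[of "2::nat" m] by (simp add: card_directions)
      then obtain a where a: "a \<in> directions m" unfolding card_gt_0_iff by blast
      \<comment> \<open>Every direction \<open>c\<close> is realised by the pair of zero and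
        \<open>c\<close>, so equal multiplicities would make all loads equal. Counting the lines by
        chosen point and by incidence then yields a common load of exactly
        \<open>d/3\<close>.\<close>
      have "load (lines m) f b = load (lines m) f a" if "b \<in> directions m" for b
      proof -
        have "{0\<^sub>v m, 0\<^sub>v m + c} \<in> pairs (boolean_points m)
          \<and> pair_multiplicity N {0\<^sub>v m, 0\<^sub>v m + c} = load (lines m) f c" if "c \<in> directions m" for c
          using that pair_multiplicity_nest[OF f _ that, of "0\<^sub>v m"]
          unfolding pairs_boolean_points N_def by auto
        from this[OF a] this[OF that] eq show ?thesis by metis
      qed
      then have "(\<Sum>b\<in>directions m. load (lines m) f b) = card (directions m) * load (lines m) f a"
        by simp
      moreover have "3 * (\<Sum>b\<in>directions m. load (lines m) f b) = d * card (directions m)"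
      proof -
        have fin: "finite (lines m)"
          using lines_subset_directions finite_directions
          by (meson PowI finite_Pow_iff finite_subset subsetI)
        have "f L \<in> directions m \<and> card (L \<inter> directions m) = 3" if "L \<in> lines m" for L
          using that lines_subset_directions[OF that] f card_line[OF that] by (metis Int_absorb2 subsetD)
        then show ?thesis
          using sum_load[OF fin finite_directions, of f m] sum_card_Int[OF fin finite_directions[of m] deg]
          by simp
      qed
      ultimately have "card (directions m) * (3 * load (lines m) f a) = card (directions m) * d"
        by (simp add: algebra_simps)
      then have "3 * load (lines m) f a = d" using \<open>card (directions m) > 0\<close> by simp
      then have "3 * load (lines m) f a = 3 * (2 * (4 ^ n div 3)) + 1" using d by simp
      then show False by presburger
    qed
    \<comment> \<open>Both multiplicities lie in an open interval of length 2 around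
      \<open>d/3\<close>, so they differ by at most one.\<close>
    moreover have "pair_multiplicity N p \<le> pair_multiplicity N q + 1"
      if "p \<in> pairs (boolean_points m)" "q \<in> pairs (boolean_points m)" for p q
      using near[OF that(1)] near[OF that(2)] by arith
    ultimately show ?thesis unfolding completely_quasi_uniform_def using pos by blast
  qed
  ultimately show ?thesis
    using nested_sqs_nest[OF f] underlying_blocks_nest[OF f] unfolding N_def by blast
qed

end
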